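(* Let $n\ge 1$, let $\varepsilon\in(0,1)$, let $\Sigma\in\mathbb{R}^{n\times n}$ be a covariance matrix (symmetric positive semidefinite), and let $\mathcal{P}$ be the set of all probability distributions on $\mathbb{R}^n$ with mean $\mu=0$ and covariance matrix $\Sigma$. Let $P\in\mathbb{R}^{n\times n}$ be symmetric, $q\in\mathbb{R}^n$, $r\in\mathbb{R}$, and define, for $\xi\in\mathbb{R}^n$, $$L_1(\xi)=\xi^\top P\xi+2q^\top\xi+r,\qquad L_2(\xi)=\xi^\top P\xi-2q^\top\xi+r.$$ Then $$\sup_{\mathbb{P}\in\mathcal{P}}\mathbb{P}\text{-CVaR}_{\varepsilon}[L_1(\xi)]=\sup_{\mathbb{P}\in\mathcal{P}}\mathbb{P}\text{-CVaR}_{\varepsilon}[L_2(\xi)].$$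
   Context: For a measurable loss function $L:\mathbb{R}^n\to\mathbb{R}$, a probability distribution $\mathbb{P}$ on $\mathbb{R}^n$ (the law of the random vector $\xi$) and a level $\varepsilon\in(0,1)$, the Conditional Value-at-Risk is $$\mathbb{P}\text{-CVaR}_{\varepsilon}[L(\xi)]=\inf_{\beta\in\mathbb{R}}\left\{\beta+\frac1\varepsilon\,\mathbb{E}_{\mathbb{P}}\big[(L(\xi)-\beta)^+\big]\right\},$$ where $(a)^+=\max(a,0)$ and $\mathbb{E}_{\mathbb{P}}$ is expectation with respect to $\mathbb{P}$. The worst-case CVaR over $\mathcal{P}$ is the supremum of this quantity over $\mathbb{P}\in\mathcal{P}$. *)

theory Defs
  imports "HOL-Probability.Probability"
begin

(* The expectation of the nonnegative variable max (L x - \<beta>) 0 is taken as a nonnegative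
   integral and the infimum in ereal, so the value is meaningful for every measurable L,
   also when an expectation is infinite or the infimum is not finite. *)
definition CVaR :: "'a measure \<Rightarrow> real \<Rightarrow> ('a \<Rightarrow> real) \<Rightarrow> ereal" where
  "CVaR M \<epsilon> L =
     (INF \<beta>::real. ereal \<beta> + ereal (1 / \<epsilon>) * enn2ereal (\<integral>\<^sup>+ x. ennreal (max (L x - \<beta>) 0) \<partial>M))"

(* The supremum is likewise taken in ereal, so no boundedness is presupposed. *)
definition worst_case_CVaR :: "'a measure set \<Rightarrow> real \<Rightarrow> ('a \<Rightarrow> real) \<Rightarrow> ereal" where
  "worst_case_CVaR \<P> \<epsilon> L = (SUP M\<in>\<P>. CVaR M \<epsilon> L)"

(* Integrability is required explicitly, since a Bochner integral that does not exist is 0. *)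
definition has_mean :: "(real ^ 'n) measure \<Rightarrow> real ^ 'n \<Rightarrow> bool" where
  "has_mean M \<mu> \<longleftrightarrow> integrable M (\<lambda>x. x) \<and> (\<integral>x. x \<partial>M) = \<mu>"

definition has_covariance :: "(real ^ 'n) measure \<Rightarrow> real ^ 'n ^ 'n \<Rightarrow> bool" where
  "has_covariance M \<Sigma> \<longleftrightarrow>
     (let m = (\<integral>x. x \<partial>M) in
       \<forall>i j. integrable M (\<lambda>x. (x $ i - m $ i) * (x $ j - m $ j)) \<and>
             (\<integral>x. (x $ i - m $ i) * (x $ j - m $ j) \<partial>M) = \<Sigma> $ i $ j)"

definition moment_ambiguity_set :: "real ^ 'n \<Rightarrow> real ^ 'n ^ 'n \<Rightarrow> (real ^ 'n) measure set" where
  "moment_ambiguity_set \<mu> \<Sigma> =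
     {M. prob_space M \<and> sets M = sets borel \<and> has_mean M \<mu> \<and> has_covariance M \<Sigma>}"

definition pos_semidef_matrix :: "real ^ 'n ^ 'n \<Rightarrow> bool" where
  "pos_semidef_matrix A \<longleftrightarrow> transpose A = A \<and> (\<forall>x. 0 \<le> x \<bullet> (A *v x))"

end

(* The law of -\<xi> has mean 0 and covariance \<Sigma> whenever the law of \<xi> does, and replacing
   \<xi> by -\<xi> turns one loss into the other. *)
theory Submission
  imports Defs
begin

text \<open>CVaR sees a law only through the distribution of the loss: for each fixed \<beta>, a
  change of variables moves a map from the measure into the loss (\<open>CVaR_distr\<close>).
  Reflection in the origin is an involution that carries laws with mean \<mu> and covariance
  \<Sigma> to laws with mean -\<mu> and the same covariance
  (\<open>uminus_distr_moment_ambiguity_set\<close>). Hence reflecting the loss amounts to negating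
  the mean (\<open>worst_case_CVaR_uminus\<close>). For \<mu> = 0 the ambiguity set is mapped to
  itself, while the two quadratic losses are reflections of each other.\<close>

lemma CVaR_distr:
  assumes "f \<in> measurable M N" and "L \<in> borel_measurable N"
  shows "CVaR (distr M N f) \<epsilon> L = CVaR M \<epsilon> (\<lambda>x. L (f x))"
  using assms unfolding CVaR_def by (subst nn_integral_distr) auto

lemma uminus_distr_moment_ambiguity_set:
  fixes M :: "(real ^ 'n) measure"
  assumes M: "M \<in> moment_ambiguity_set \<mu> \<Sigma>"
  shows "distr M borel uminus \<in> moment_ambiguity_set (- \<mu>) \<Sigma>"
proof -
  have [measurable_cong]: "sets M = sets borel" and "prob_space M"
    and mean: "integrable M (\<lambda>x. x)" "(\<integral>x. x \<partial>M) = \<mu>"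
    and cov: "integrable M (\<lambda>x. (x $ i - \<mu> $ i) * (x $ j - \<mu> $ j))"
      "(\<integral>x. (x $ i - \<mu> $ i) * (x $ j - \<mu> $ j) \<partial>M) = \<Sigma> $ i $ j" for i j
    using M by (auto simp: moment_ambiguity_set_def has_mean_def has_covariance_def Let_def)
  have um [measurable]: "(uminus :: real ^ 'n \<Rightarrow> real ^ 'n) \<in> measurable M borel"
    by measurable
  have nth [measurable]: "(\<lambda>x :: real ^ 'n. x $ i) \<in> borel_measurable borel" for i
    by (intro borel_measurable_continuous_onI continuous_intros)
  \<comment> \<open>Besides giving the mean, this fixes the centre about which the covariance of the
    reflected law is taken.\<close>
  have mean': "(\<integral>x. x \<partial>distr M borel uminus) = - \<mu>"
    by (simp add: integral_distr mean)
  have "integrable (distr M borel uminus) (\<lambda>x. x)"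
    unfolding integrable_distr_eq[OF um measurable_ident_sets[OF refl]]
    by (rule integrable_minus[OF mean(1)])
  then have "has_mean (distr M borel uminus) (- \<mu>)"
    by (simp only: has_mean_def mean')
  moreover have "has_covariance (distr M borel uminus) \<Sigma>"
    unfolding has_covariance_def mean' Let_def
  proof (intro allI conjI)
    fix i j
    let ?f = "\<lambda>x :: real ^ 'n. (x $ i - (- \<mu>) $ i) * (x $ j - (- \<mu>) $ j)"
    have f: "?f \<in> borel_measurable borel"
      by measurable
    \<comment> \<open>Each centred coordinate changes sign, and the two signs cancel in the
      product.\<close>
    have f_neg: "?f (- x) = (x $ i - \<mu> $ i) * (x $ j - \<mu> $ j)" for x
      by (simp add: algebra_simps)
    show "integrable (distr M borel uminus) ?f"
      unfolding integrable_distr_eq[OF um f] f_neg by (rule cov)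
    show "(\<integral>x. ?f x \<partial>distr M borel uminus) = \<Sigma> $ i $ j"
      unfolding integral_distr[OF um f] f_neg by (rule cov)
  qed
  ultimately show ?thesis
    using prob_space.prob_space_distr[OF \<open>prob_space M\<close> um]
    by (simp add: moment_ambiguity_set_def)
qed

text \<open>Every law competing on the left has a reflected law competing on the right that attains
  the same CVaR.\<close>

lemma worst_case_CVaR_uminus_le:
  fixes L :: "real ^ 'n \<Rightarrow> real"
  assumes L: "L \<in> borel_measurable borel"
  shows "worst_case_CVaR (moment_ambiguity_set \<mu> \<Sigma>) \<epsilon> (\<lambda>x. L (- x))
    \<le> worst_case_CVaR (moment_ambiguity_set (- \<mu>) \<Sigma>) \<epsilon> L"
  unfolding worst_case_CVaR_def
proof (rule SUP_least)
  fix M :: "(real ^ 'n) measure"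
  assume M: "M \<in> moment_ambiguity_set \<mu> \<Sigma>"
  then have [measurable_cong]: "sets M = sets borel"
    by (simp add: moment_ambiguity_set_def)
  have "CVaR M \<epsilon> (\<lambda>x. L (- x)) = CVaR (distr M borel uminus) \<epsilon> L"
    using L by (subst CVaR_distr) auto
  also have "\<dots> \<le> (SUP M\<in>moment_ambiguity_set (- \<mu>) \<Sigma>. CVaR M \<epsilon> L)"
    by (intro SUP_upper uminus_distr_moment_ambiguity_set M)
  finally show "CVaR M \<epsilon> (\<lambda>x. L (- x)) \<le> (SUP M\<in>moment_ambiguity_set (- \<mu>) \<Sigma>. CVaR M \<epsilon> L)" .
qed

text \<open>Reflection is its own inverse, so the reverse inequality is the same bound applied to
  the reflected loss and the mean -\<mu>; the double negations cancel.\<close>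

lemma worst_case_CVaR_uminus:
  fixes L :: "real ^ 'n \<Rightarrow> real"
  assumes [measurable]: "L \<in> borel_measurable borel"
  shows "worst_case_CVaR (moment_ambiguity_set \<mu> \<Sigma>) \<epsilon> (\<lambda>x. L (- x))
    = worst_case_CVaR (moment_ambiguity_set (- \<mu>) \<Sigma>) \<epsilon> L"
  using worst_case_CVaR_uminus_le[of L \<mu> \<Sigma> \<epsilon>]
    worst_case_CVaR_uminus_le[of "\<lambda>x. L (- x)" "- \<mu>" \<Sigma> \<epsilon>]
  by (intro antisym) simp_all

theorem mainTheorem1:
  fixes \<epsilon> :: real
    and \<Sigma> P :: "real ^ 'n ^ 'n"
    and q :: "real ^ 'n"
    and r :: real
  assumes "0 < \<epsilon>" and "\<epsilon> < 1"
    and "pos_semidef_matrix \<Sigma>"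
    and "transpose P = P"
  shows "worst_case_CVaR (moment_ambiguity_set 0 \<Sigma>) \<epsilon> (\<lambda>\<xi>. \<xi> \<bullet> (P *v \<xi>) + 2 * (q \<bullet> \<xi>) + r)
       = worst_case_CVaR (moment_ambiguity_set 0 \<Sigma>) \<epsilon> (\<lambda>\<xi>. \<xi> \<bullet> (P *v \<xi>) - 2 * (q \<bullet> \<xi>) + r)"
proof -
  let ?L = "\<lambda>\<xi>. \<xi> \<bullet> (P *v \<xi>) - 2 * (q \<bullet> \<xi>) + r"
  \<comment> \<open>The quadratic part of the loss is even and the linear part odd, so reflection
    flips only the sign of the \<open>q\<close> term.\<close>
  have "P *v (- \<xi>) = - (P *v \<xi>)" for \<xi>
    by (rule linear_neg) simp
  then have reflect: "?L (- \<xi>) = \<xi> \<bullet> (P *v \<xi>) + 2 * (q \<bullet> \<xi>) + r" for \<xi>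
    by simp
  have "?L \<in> borel_measurable borel"
    by (intro borel_measurable_continuous_onI continuous_intros linear_continuous_on
        matrix_vector_mul_bounded_linear)
  \<comment> \<open>Since -0 = 0, both sides range over the same ambiguity set.\<close>
  then show ?thesis
    using worst_case_CVaR_uminus[of ?L 0 \<Sigma> \<epsilon>] unfolding reflect by simp
qed

end
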